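(* For every integer $n\ge 0$, the number of Dyck bridges of semi-length $n$ with non-decreasing summits is equal to the odd-indexed Fibonacci number $F_{2n+1}$, where $F_0=0$, $F_1=1$ and $F_m=F_{m-1}+F_{m-2}$ for $m\ge 2$.
   Context: A Dyck bridge of semi-length $n$ is a lattice path from $(0,0)$ to $(2n,0)$ with steps $\mathtt{u}=(1,1)$ and $\mathtt{d}=(1,-1)$ (it may go below the $x$-axis). A summit of a path is a point of the path that has a larger ordinate than all its direct neighbors on the path. Thus in a Dyck bridge, an interior point is a summit iff it lies between a $\mathtt{u}$ step and a following $\mathtt{d}$ step, the starting point is a summit iff the first step is $\mathtt{d}$, and the end point is a summit iff the last step is $\mathtt{u}$. A bridge has non-decreasing summits if the ordinates of its summits, read from left to right, form a weakly increasing sequence. *)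

theory Defs
  imports "HOL-Library.Product_Plus" "HOL-Number_Theory.Fib"
begin

datatype step = U | D

fun step_vec :: "step \<Rightarrow> int \<times> int" where
  "step_vec U = (1, 1)"
| "step_vec D = (1, -1)"

text \<open>A lattice path starting at the origin is represented by its list of steps; its points are
  indexed by \<open>0, \<dots>, length w\<close>, with point \<open>i\<close> having abscissa \<open>i\<close>.\<close>

definition path_point :: "step list \<Rightarrow> nat \<Rightarrow> int \<times> int" where
  "path_point w i = (\<Sum>s\<leftarrow>take i w. step_vec s)"

definition ordinate :: "step list \<Rightarrow> nat \<Rightarrow> int" where
  "ordinate w i = snd (path_point w i)"

definition dyck_bridge :: "nat \<Rightarrow> step list \<Rightarrow> bool" where
  "dyck_bridge n w \<longleftrightarrow> path_point w (length w) = (2 * int n, 0)"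

text \<open>The end points have only one neighbor. The single point of the empty path has none and is a
  summit vacuously, which has no influence on monotonicity of the summit ordinates.\<close>

definition summit :: "step list \<Rightarrow> nat \<Rightarrow> bool" where
  "summit w i \<longleftrightarrow> i \<le> length w \<and>
     (\<forall>j\<le>length w. j = i + 1 \<or> i = j + 1 \<longrightarrow> ordinate w j < ordinate w i)"

definition nondecreasing_summits :: "step list \<Rightarrow> bool" where
  "nondecreasing_summits w \<longleftrightarrow>
     (\<forall>i j. summit w i \<and> summit w j \<and> i < j \<longrightarrow> ordinate w i \<le> ordinate w j)"

end

theory Submission
  imports Defs
begin

text \<open>The path leaves a summit by a maximal run of down steps, and the next summit is at least as
  high iff the following run of up steps is at least as long. Hence the paths with non-decreasing
  summits are exactly the words in the unambiguous language
  \<open>{U, D U, D\<^sup>2 U\<^sup>2, D\<^sup>3 U\<^sup>3, \<dots>}\<^sup>* D\<^sup>*\<close>. For a bridge the final run of down steps is determined by the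
  rest, so the bridges correspond to the sequences of blocks with \<open>n\<close> up steps in total. Splitting
  off the first block gives \<open>a (n + 1) = a n + (a 0 + \<dots> + a n)\<close>, the recurrence of \<open>F (2 n + 1)\<close>.\<close>

subsection \<open>Summits of a path and of its tail\<close>

lemma ordinate_0 [simp]: "ordinate w 0 = 0"
  by (simp add: ordinate_def path_point_def)

lemma ordinate_Cons_Suc [simp]:
  "ordinate (s # w) (Suc i) = snd (step_vec s) + ordinate w i"
  by (simp add: ordinate_def path_point_def)

lemma ordinate_Suc:
  "i < length w \<Longrightarrow> ordinate w (Suc i) = ordinate w i + snd (step_vec (w ! i))"
  by (simp add: ordinate_def path_point_def take_Suc_conv_app_nth)

text \<open>Each step changes the ordinate by exactly one, so comparing a point with a neighbor only
  tests the step between them.\<close>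

lemma summit_iff:
  "summit w i \<longleftrightarrow> i \<le> length w \<and> (i < length w \<longrightarrow> w ! i = D) \<and> (0 < i \<longrightarrow> w ! (i - 1) = U)"
proof -
  have "i < length w \<Longrightarrow> ordinate w (Suc i) < ordinate w i \<longleftrightarrow> w ! i = D"
    by (cases "w ! i") (simp_all add: ordinate_Suc)
  moreover have "0 < i \<Longrightarrow> i \<le> length w \<Longrightarrow> ordinate w (i - 1) < ordinate w i \<longleftrightarrow> w ! (i - 1) = U"
    using ordinate_Suc[of "i - 1" w] by (cases "w ! (i - 1)") simp_all
  moreover have "summit w i \<longleftrightarrow> i \<le> length w \<and> (i < length w \<longrightarrow> ordinate w (Suc i) < ordinate w i) \<and>
      (0 < i \<longrightarrow> ordinate w (i - 1) < ordinate w i)"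
    unfolding summit_def by (cases i) (auto simp: Suc_le_eq imp_conjR all_conj_distrib)
  ultimately show ?thesis by auto
qed

lemma summit_Nil [simp]: "summit [] i \<longleftrightarrow> i = 0"
  by (auto simp: summit_iff)

lemma summit_Cons_0 [simp]: "summit (s # w) 0 \<longleftrightarrow> s = D"
  by (simp add: summit_iff)

lemma summit_U_Suc [simp]: "summit (U # w) (Suc i) \<longleftrightarrow> summit w i"
  by (cases i) (simp_all add: summit_iff)

lemma summit_D_Suc [simp]: "summit (D # w) (Suc i) \<longleftrightarrow> 0 < i \<and> summit w i"
  by (cases i) (simp_all add: summit_iff)

text \<open>An invariant for reading the path step by step: \<open>m\<close> is a lower bound
  inherited from summits already passed, relative to the start of \<open>w\<close>. Only
  \<open>a = 0\<close> and \<open>a = 1\<close> occur; the value 1 skips the starting point, which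
  is no summit once a \<open>D\<close> has been read before it.\<close>

definition summits_above :: "nat \<Rightarrow> int \<Rightarrow> step list \<Rightarrow> bool" where
  "summits_above a m w \<longleftrightarrow>
     (\<forall>i\<ge>a. summit w i \<longrightarrow> m \<le> ordinate w i \<and>
        (\<forall>j>i. summit w j \<longrightarrow> ordinate w i \<le> ordinate w j))"

lemma all_ge_Suc: "(\<forall>i\<ge>Suc a. P i) \<longleftrightarrow> (\<forall>i\<ge>a. P (Suc i))"
  by (metis Suc_le_D Suc_le_mono)

lemma all_gt_Suc: "(\<forall>i>Suc a. P i) \<longleftrightarrow> (\<forall>i>a. P (Suc i))"
  by (metis Suc_less_eq Suc_less_eq2)

lemma all_ge_0: "(\<forall>i\<ge>0. P i) \<longleftrightarrow> P 0 \<and> (\<forall>i\<ge>Suc 0. P i)"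
  by (metis le0 not0_implies_Suc Suc_le_mono)

lemma summits_above_Nil [simp]:
  "summits_above 0 m [] \<longleftrightarrow> m \<le> 0" "summits_above (Suc 0) m []"
  by (auto simp: summits_above_def)

lemma summits_above_1_U [simp]:
  "summits_above (Suc 0) m (U # w) \<longleftrightarrow> summits_above 0 (m - 1) w"
  unfolding summits_above_def all_ge_Suc all_gt_Suc by (simp add: algebra_simps)

lemma summits_above_0_U [simp]:
  "summits_above 0 m (U # w) \<longleftrightarrow> summits_above 0 (m - 1) w"
  unfolding summits_above_1_U[symmetric] unfolding summits_above_def
  by (subst all_ge_0) simp

lemma summits_above_1_D [simp]:
  "summits_above (Suc 0) m (D # w) \<longleftrightarrow> summits_above (Suc 0) (m + 1) w"
proof -
  have "summits_above (Suc 0) m (D # w) \<longleftrightarrow>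
      (\<forall>i\<ge>0. 0 < i \<and> summit w i \<longrightarrow> m + 1 \<le> ordinate w i \<and>
        (\<forall>j>i. summit w j \<longrightarrow> ordinate w i \<le> ordinate w j))"
    unfolding summits_above_def all_ge_Suc all_gt_Suc
    by (auto simp: algebra_simps)
  also have "\<dots> \<longleftrightarrow> summits_above (Suc 0) (m + 1) w"
    unfolding summits_above_def by (auto simp: Suc_le_eq)
  finally show ?thesis .
qed

text \<open>The starting point is now a summit of height 0. It replaces the weaker bound
  \<open>m\<close>, and seen from one level lower the new bound is 1.\<close>

lemma summits_above_0_D [simp]:
  "summits_above 0 m (D # w) \<longleftrightarrow> m \<le> 0 \<and> summits_above (Suc 0) 1 w"
proof -
  have "summits_above 0 m (D # w) \<longleftrightarrow>
      m \<le> 0 \<and> (\<forall>j>0. summit (D # w) j \<longrightarrow> 0 \<le> ordinate (D # w) j) \<and>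
      summits_above (Suc 0) m (D # w)"
    unfolding summits_above_def by (subst all_ge_0) simp
  also have "\<dots> \<longleftrightarrow> m \<le> 0 \<and> summits_above (Suc 0) 0 (D # w)"
    unfolding summits_above_def Suc_le_eq by (meson order_trans)
  finally have "summits_above 0 m (D # w) \<longleftrightarrow> m \<le> 0 \<and> summits_above (Suc 0) 0 (D # w)" .
  then show ?thesis by simp
qed

text \<open>The first summit is reached from the origin by up steps only.\<close>

lemma nondecreasing_summits_iff: "nondecreasing_summits w \<longleftrightarrow> summits_above 0 0 w"
proof
  have nonneg: "summits_above 0 0 w" if "summits_above 0 m w" for m
    using that
  proof (induction w arbitrary: m)
    case (Cons s w)
    show ?case
    proof (cases s)
      case U
      with Cons.prems have "summits_above 0 (m - 1) w" by simp
      then have "summits_above 0 0 w" by (rule Cons.IH)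
      then have "summits_above 0 (- 1) w" unfolding summits_above_def by force
      then show ?thesis by (simp add: U)
    next
      case D
      with Cons.prems show ?thesis by simp
    qed
  qed auto
  assume *: "nondecreasing_summits w"
  \<comment> \<open>\<open>nonneg\<close> accepts any lower bound; the least ordinate on the finite
    path provides one.\<close>
  define m where "m = Min (ordinate w ` {..length w})"
  have "m \<le> ordinate w i" if "summit w i" for i
    using that unfolding m_def summit_def by (intro Min_le) auto
  with * have "summits_above 0 m w"
    unfolding nondecreasing_summits_def summits_above_def by blast
  then show "summits_above 0 0 w" by (rule nonneg)
qed (auto simp: nondecreasing_summits_def summits_above_def)

lemma summits_above_mono: "summits_above a m w \<Longrightarrow> m' \<le> m \<Longrightarrow> summits_above a m' w"
  unfolding summits_above_def by (meson order_trans)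

text \<open>Any bound already makes the summits non-decreasing, and then the first summit, lying at
  height at least 0, bounds all others from below.\<close>

lemma summits_above_0_nonpos:
  assumes "m \<le> 0"
  shows "summits_above 0 m w \<longleftrightarrow> summits_above 0 0 w"
proof
  assume "summits_above 0 m w"
  then have "nondecreasing_summits w"
    by (auto simp: nondecreasing_summits_def summits_above_def)
  then show "summits_above 0 0 w" by (simp add: nondecreasing_summits_iff)
qed (use assms summits_above_mono in blast)

subsection \<open>Decomposition into blocks\<close>

text \<open>The number \<open>0\<close> encodes the block \<open>U\<close>, and \<open>k > 0\<close> encodes \<open>D\<^sup>k U\<^sup>k\<close>.\<close>

definition block :: "nat \<Rightarrow> step list" where
  "block k = (if k = 0 then [U] else replicate k D @ replicate k U)"

abbreviation blocks :: "nat list \<Rightarrow> step list" where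
  "blocks ks \<equiv> concat (map block ks)"

lemma summits_above_replicate_U:
  "summits_above 0 m (replicate k U @ w) \<longleftrightarrow> summits_above 0 (m - int k) w"
  by (induction k arbitrary: m) (simp_all add: algebra_simps)

lemma summits_above_replicate_D:
  "summits_above (Suc 0) m (replicate k D @ w) \<longleftrightarrow> summits_above (Suc 0) (m + int k) w"
  by (induction k arbitrary: m) (simp_all add: algebra_simps)

text \<open>For \<open>k > 0\<close> the down run raises the relative bound to \<open>k\<close> and
  the up run brings it back to 0. The block \<open>U\<close> yields the bound -1, which is as good
  as 0.\<close>

lemma summits_above_block: "summits_above 0 0 (block k @ w) \<longleftrightarrow> summits_above 0 0 w"
proof (cases k)
  case 0
  then show ?thesis using summits_above_0_nonpos[of "- 1" w] by (simp add: block_def)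
next
  case (Suc l)
  then show ?thesis
    using summits_above_replicate_D[of 1 l "U # replicate l U @ w"]
      summits_above_replicate_U[of "int l" l w]
    by (simp add: block_def)
qed

lemma summits_above_blocks: "summits_above 0 0 (blocks ks @ replicate j D)"
proof (induction ks)
  case Nil
  show ?case
    using summits_above_replicate_D[of 1 "j - 1" "[]"] by (cases j) auto
qed (simp add: summits_above_block)

text \<open>Here \<open>k\<close> counts the up steps owed before the next summit. The two claims
  treat a path read afresh and one read in the middle of a descent; they are proved together because
  a \<open>D\<close> leads from the first to the second and a \<open>U\<close> from the second to
  the first.\<close>

lemma decomposition_step:
  "(summits_above 0 (int k) w \<longrightarrow> (\<exists>ks j. w = replicate k U @ blocks ks @ replicate j D)) \<and>
   (summits_above (Suc 0) (int k) w \<longrightarrow>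
      (\<exists>j. w = replicate j D) \<or>
      (\<exists>l ks j. w = replicate l D @ replicate (k + l) U @ blocks ks @ replicate j D))"
proof (induction w arbitrary: k)
  case Nil
  have "[] = blocks [] @ replicate 0 D" by simp
  then show ?case by (auto intro: exI[of _ "[]"])
next
  case (Cons s w)
  show ?case
  proof (cases s)
    case U
    have up: "\<exists>ks j. U # w = replicate k U @ blocks ks @ replicate j D"
      if *: "summits_above 0 (int k - 1) w"
    proof (cases k)
      \<comment> \<open>With no up steps owed, this \<open>U\<close> is a block of its own.\<close>
      case 0
      with * have "summits_above 0 (int 0) w" by (simp add: summits_above_0_nonpos[of "- 1"])
      with Cons[of 0] obtain ks j where "w = blocks ks @ replicate j D" by auto
      then have "U # w = blocks (0 # ks) @ replicate j D" by (simp add: block_def)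
      with 0 show ?thesis by (metis append_Nil replicate_0)
    next
      case (Suc k')
      with * Cons[of k'] show ?thesis by auto
    qed
    show ?thesis
    proof (intro conjI impI)
      assume "summits_above (Suc 0) (int k) (s # w)"
      with U up obtain ks j where "s # w = replicate k U @ blocks ks @ replicate j D" by auto
      \<comment> \<open>The descent has already ended, so \<open>l = 0\<close>.\<close>
      then have "s # w = replicate 0 D @ replicate (k + 0) U @ blocks ks @ replicate j D" by simp
      then show "(\<exists>j. s # w = replicate j D) \<or>
        (\<exists>l ks j. s # w = replicate l D @ replicate (k + l) U @ blocks ks @ replicate j D)"
        by blast
    qed (use U up in auto)
  next
    case D
    show ?thesis
    proof (intro conjI impI)
      assume "summits_above 0 (int k) (s # w)"
      with D have k: "k = 0" and "summits_above (Suc 0) (int 1) w" by auto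
      with Cons[of 1] consider j where "w = replicate j D"
        | l ks j where "w = replicate l D @ replicate (1 + l) U @ blocks ks @ replicate j D"
        by blast
      then show "\<exists>ks j. s # w = replicate k U @ blocks ks @ replicate j D"
      proof cases
        case 1
        then have "s # w = replicate k U @ blocks [] @ replicate (Suc j) D"
          by (simp add: k D)
        then show ?thesis by blast
      next
        case 2
        then have "s # w = replicate k U @ blocks (Suc l # ks) @ replicate j D"
          by (simp add: k D block_def)
        then show ?thesis by blast
      qed
    next
      assume "summits_above (Suc 0) (int k) (s # w)"
      with D have "summits_above (Suc 0) (int (Suc k)) w" by (simp add: algebra_simps)
      with Cons[of "Suc k"] consider j where "w = replicate j D"
        | l ks j where "w = replicate l D @ replicate (Suc k + l) U @ blocks ks @ replicate j D"
        by blast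
      then show "(\<exists>j. s # w = replicate j D) \<or>
        (\<exists>l ks j. s # w = replicate l D @ replicate (k + l) U @ blocks ks @ replicate j D)"
      proof cases
        case 1
        then have "s # w = replicate (Suc j) D" by (simp add: D)
        then show ?thesis by blast
      next
        case 2
        then have "s # w =
            replicate (Suc l) D @ replicate (k + Suc l) U @ blocks ks @ replicate j D"
          by (simp add: D)
        then show ?thesis by blast
      qed
    qed
  qed
qed

lemma nondecreasing_summits_iff_blocks:
  "nondecreasing_summits w \<longleftrightarrow> (\<exists>ks j. w = blocks ks @ replicate j D)"
  using decomposition_step[of 0 w] summits_above_blocks
  by (auto simp: nondecreasing_summits_iff)

section \<open>Uniqueness of the block decomposition\<close>

lemma replicate_D_append_U_eq:
  "replicate k D @ U # v = replicate l D @ U # w \<Longrightarrow> k = l \<and> v = w"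
proof (induction k arbitrary: l)
  case 0
  then show ?case by (cases l) auto
next
  case (Suc k)
  then show ?case by (cases l) auto
qed

text \<open>Truncated subtraction lets one formula cover both kinds of block; it shows that
  \<open>k\<close> can be read off as the number of \<open>D\<close> before the first
  \<open>U\<close>.\<close>

lemma block_eq_Cons_U: "block k = replicate k D @ U # replicate (k - 1) U"
  by (cases k) (auto simp: block_def)

lemma blocks_inj:
  "blocks ks @ replicate i D = blocks ls @ replicate j D \<Longrightarrow> ks = ls"
proof (induction ks arbitrary: ls)
  case Nil
  \<comment> \<open>Every block contains a \<open>U\<close>, so a word without \<open>U\<close> has
    no blocks.\<close>
  have "U \<notin> set (blocks [] @ replicate i D)" by simp
  then have "U \<notin> set (blocks ls)" unfolding Nil.prems by simp
  then show ?case by (cases ls) (simp_all add: block_eq_Cons_U)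
next
  case (Cons k ks)
  have "U \<in> set (blocks (k # ks) @ replicate i D)" by (simp add: block_eq_Cons_U)
  then have "U \<in> set (blocks ls @ replicate j D)" unfolding Cons.prems .
  then obtain l ls' where ls: "ls = l # ls'" by (cases ls) simp_all
  have "replicate k D @ U # replicate (k - 1) U @ blocks ks @ replicate i D =
      replicate l D @ U # replicate (l - 1) U @ blocks ls' @ replicate j D"
    using Cons.prems by (simp add: ls block_eq_Cons_U[of k] block_eq_Cons_U[of l])
  from replicate_D_append_U_eq[OF this]
  have "k = l" and "blocks ks @ replicate i D = blocks ls' @ replicate j D"
    by auto
  with Cons.IH show ?case by (simp add: ls)
qed

subsection \<open>Counting\<close>

lemma path_point_length:
  "path_point w (length w) =
     (int (count_list w U) + int (count_list w D), int (count_list w U) - int (count_list w D))"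
proof (induction w)
  case (Cons s w)
  then show ?case by (cases s) (auto simp: path_point_def)
qed (simp add: path_point_def zero_prod_def)

lemma dyck_bridge_iff: "dyck_bridge n w \<longleftrightarrow> count_list w U = n \<and> count_list w D = n"
  by (auto simp: dyck_bridge_def path_point_length)

lemma count_list_replicate: "count_list (replicate k x) y = (if x = y then k else 0)"
  by (induction k) auto

lemma count_U_blocks: "count_list (blocks ks) U = sum_list (map (max 1) ks)"
  by (induction ks) (auto simp: block_def count_list_replicate)

lemma count_D_blocks: "count_list (blocks ks) D = sum_list ks"
  by (induction ks) (auto simp: block_def count_list_replicate)

text \<open>\<open>max 1 k\<close> is the number of up steps of \<open>block k\<close>, since the
  code 0 stands for a single \<open>U\<close>.\<close>

definition codes :: "nat \<Rightarrow> nat list set" where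
  "codes n = {ks. sum_list (map (max 1) ks) = n}"

lemma bridges_eq_image_codes:
  "{w. dyck_bridge n w \<and> nondecreasing_summits w} =
     (\<lambda>ks. blocks ks @ replicate (n - sum_list ks) D) ` codes n"
proof -
  \<comment> \<open>No block descends more than it climbs, so \<open>n - sum_list ks\<close> is a
    true difference: the number of final down steps that return to height 0.\<close>
  have le: "sum_list ks \<le> sum_list (map (max 1) ks)" for ks :: "nat list"
    by (induction ks) auto
  show ?thesis
  proof (intro equalityI subsetI)
    fix w assume "w \<in> {w. dyck_bridge n w \<and> nondecreasing_summits w}"
    then obtain ks j where "w = blocks ks @ replicate j D" and "dyck_bridge n w"
      by (auto simp: nondecreasing_summits_iff_blocks)
    then have "sum_list (map (max 1) ks) = n" "w = blocks ks @ replicate (n - sum_list ks) D"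
      by (auto simp: dyck_bridge_iff count_U_blocks count_D_blocks count_list_replicate)
    then show "w \<in> (\<lambda>ks. blocks ks @ replicate (n - sum_list ks) D) ` codes n"
      by (auto simp: codes_def)
  next
    fix w assume "w \<in> (\<lambda>ks. blocks ks @ replicate (n - sum_list ks) D) ` codes n"
    then obtain ks where ks: "sum_list (map (max 1) ks) = n"
      and w: "w = blocks ks @ replicate (n - sum_list ks) D"
      by (auto simp: codes_def)
    have "dyck_bridge n w"
      using ks le[of ks]
      by (simp add: w dyck_bridge_iff count_U_blocks count_D_blocks count_list_replicate)
    then show "w \<in> {w. dyck_bridge n w \<and> nondecreasing_summits w}"
      by (auto simp: nondecreasing_summits_iff_blocks w)
  qed
qed

lemma codes_0: "codes 0 = {[]}"
proof -
  have "ks = []" if "sum_list (map (max 1) ks) = 0" for ks :: "nat list"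
    using that by (cases ks) auto
  then show ?thesis by (auto simp: codes_def)
qed

text \<open>Splits by the first code. In the union, \<open>k\<close> is the number of up steps left
  for the tail; the codes 0 and 1 both leave \<open>n\<close>.\<close>

lemma codes_Suc:
  "codes (Suc n) = (#) 0 ` codes n \<union> (\<Union>k\<le>n. (#) (Suc (n - k)) ` codes k)"
proof (intro equalityI subsetI)
  fix ks assume *: "ks \<in> codes (Suc n)"
  then obtain k ks' where ks: "ks = k # ks'"
    by (cases ks) (auto simp: codes_def)
  show "ks \<in> (#) 0 ` codes n \<union> (\<Union>k\<le>n. (#) (Suc (n - k)) ` codes k)"
  proof (cases k)
    case 0
    with * show ?thesis by (simp add: ks codes_def)
  next
    case (Suc k')
    with * have "sum_list (map (max 1) ks') = n - k'" "k' \<le> n"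
      by (auto simp: ks codes_def)
    then show ?thesis
      by (intro UnI2 UN_I[of "n - k'"]) (auto simp: ks Suc codes_def)
  qed
qed (auto simp: codes_def)

lemma finite_codes: "finite (codes n)"
proof (induction n rule: less_induct)
  case (less n)
  then show ?case
    by (cases n) (auto simp: codes_0 codes_Suc)
qed

text \<open>The pieces are disjoint because their lists have different heads.\<close>

lemma card_codes_Suc: "card (codes (Suc n)) = card (codes n) + (\<Sum>k\<le>n. card (codes k))"
proof -
  have "card (\<Union>k\<le>n. (#) (Suc (n - k)) ` codes k) = (\<Sum>k\<le>n. card ((#) (Suc (n - k)) ` codes k))"
    by (rule card_UN_disjoint) (auto simp: finite_codes)
  also have "\<dots> = (\<Sum>k\<le>n. card (codes k))"
    by (simp add: card_image)
  finally show ?thesis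
    unfolding codes_Suc
    by (subst card_Un_disjoint) (auto simp: finite_codes card_image)
qed

lemma sum_fib_odd: "(\<Sum>k\<le>n. fib (2 * k + 1)) = fib (2 * n + 2)"
  by (induction n) auto

lemma card_codes: "card (codes n) = fib (2 * n + 1)"
proof (induction n rule: less_induct)
  case (less n)
  show ?case
  proof (cases n)
    case 0
    then show ?thesis by (simp add: codes_0)
  next
    case (Suc m)
    have "card (codes n) = fib (2 * m + 1) + (\<Sum>k\<le>m. fib (2 * k + 1))"
      unfolding Suc card_codes_Suc using less by (simp add: Suc)
    \<comment> \<open>The sum is \<open>fib (2 * m + 2)\<close>, so one Fibonacci step gives
      \<open>fib (2 * m + 3)\<close>.\<close>
    also have "\<dots> = fib (2 * n + 1)"
      unfolding sum_fib_odd by (simp add: Suc)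
    finally show ?thesis .
  qed
qed

theorem theorem4p2:
  fixes n :: nat
  shows "card {w. dyck_bridge n w \<and> nondecreasing_summits w} = fib (2 * n + 1)"
proof -
  have "inj_on (\<lambda>ks. blocks ks @ replicate (n - sum_list ks) D) (codes n)"
    \<comment> \<open>\<open>blocks_inj\<close> allows different final runs, as needed for exponents
      that depend on \<open>ks\<close>.\<close>
    by (rule inj_onI) (rule blocks_inj)
  then show ?thesis
    by (simp add: bridges_eq_image_codes card_image card_codes)
qed

end
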